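(* Let $\mathcal{H}$ be a separable Hilbert space. Every biframe $(F,G)=(\{f_k\}_{k=1}^\infty,\{g_k\}_{k=1}^\infty)$ for $\mathcal{H}$ is a pair frame for $\mathcal{H}$.
   Context: A pair $(F,G)=(\{f_k\}_{k=1}^\infty,\{g_k\}_{k=1}^\infty)$ of sequences in $\mathcal{H}$ is called a biframe for $\mathcal{H}$ if there exist positive constants $A$ and $B$ such that $A\|f\|^2\le\sum_{k=1}^\infty\langle f,f_k\rangle\langle g_k,f\rangle\le B\|f\|^2$ for all $f\in\mathcal{H}$. A pair $(F,G)$ of sequences in $\mathcal{H}$ is a pair frame for $\mathcal{H}$ if the pair frame operator $Sf=\sum_{k=1}^\infty\langle f,f_k\rangle g_k$, $f\in\mathcal{H}$, is well-defined and invertible. The inner product is linear in the first variable.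
   Formalization: The scalars are complex, and the series defining Sf is taken to converge weakly (paired with every vector h): for norm convergence the claim is false, e.g. for the pairs (e_k,e_k), (e_0,e_k), (e_0,-e_k), k=0,1,..., with e an infinite orthonormal basis. *)

theory Defs
  imports "HOL-Analysis.Analysis"
begin

text \<open>Complex Hilbert spaces. The real normed structure is inherited from \<^class>\<open>banach\<close>, so that
  the library's topology, \<^const>\<open>sums\<close> and \<^const>\<open>bounded_linear\<close> are available; completeness is
  part of \<^class>\<open>banach\<close>. The inner product is linear in the first variable.\<close>

class complex_hilbert_space = banach +
  fixes scaleC :: "complex \<Rightarrow> 'a \<Rightarrow> 'a"  (infixr "*\<^sub>C" 75)
    and cinner :: "'a \<Rightarrow> 'a \<Rightarrow> complex"
  assumes scaleC_add_right: "a *\<^sub>C (x + y) = a *\<^sub>C x + a *\<^sub>C y"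
    and scaleC_add_left: "(a + b) *\<^sub>C x = a *\<^sub>C x + b *\<^sub>C x"
    and scaleC_scaleC: "a *\<^sub>C (b *\<^sub>C x) = (a * b) *\<^sub>C x"
    and scaleC_of_real: "complex_of_real r *\<^sub>C x = r *\<^sub>R x"
    and cinner_add_left: "cinner (x + y) z = cinner x z + cinner y z"
    and cinner_scaleC_left: "cinner (a *\<^sub>C x) y = a * cinner x y"
    and cinner_commute: "cinner x y = cnj (cinner y x)"
    and cinner_ge_zero: "0 \<le> Re (cinner x x)"
    and norm_eq_sqrt_cinner: "norm x = sqrt (Re (cinner x x))"

instantiation complex :: complex_hilbert_space
begin

definition scaleC_complex :: "complex \<Rightarrow> complex \<Rightarrow> complex"
  where "scaleC_complex a x = a * x"

definition cinner_complex :: "complex \<Rightarrow> complex \<Rightarrow> complex"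
  where "cinner_complex x y = x * cnj y"

instance
  by standard
    (auto simp: scaleC_complex_def cinner_complex_def algebra_simps scaleR_conv_of_real
      cmod_def power2_eq_square)

end

text \<open>Sequences are indexed from \<open>0\<close> instead of \<open>1\<close>. The two inequalities presuppose that the
  series of complex numbers converges (in the given order) and that its sum is real.\<close>

definition biframe ::
    "(nat \<Rightarrow> 'a::complex_hilbert_space) \<Rightarrow> (nat \<Rightarrow> 'a) \<Rightarrow> bool"
  where "biframe F G \<longleftrightarrow> (\<exists>A>0. \<exists>B>0. \<forall>f. \<exists>s::real.
    (\<lambda>k. cinner f (F k) * cinner (G k) f) sums complex_of_real s \<and>
    A * (norm f)\<^sup>2 \<le> s \<and> s \<le> B * (norm f)\<^sup>2)"

text \<open>Like the biframe series \<open>\<langle>Sf, f\<rangle>\<close>, the vector series defining the operator \<open>S\<close> is understood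
  weakly: its partial sums, paired with any vector \<open>h\<close>, converge. A biframe need not make
  the partial sums converge in norm: with an orthonormal basis \<open>e\<close>, listing for
  \<open>k = 0, 1, \<dots>\<close> the pairs \<open>(e k, e k)\<close>, \<open>(e 0, e k)\<close>, \<open>(e 0, - e k)\<close> gives a biframe with
  \<open>A = B = 1\<close>, but the partial sums at \<open>f = e 0\<close> keep oscillating by the unit vectors \<open>e k\<close>.\<close>

definition weakly_sums :: "(nat \<Rightarrow> 'a::complex_hilbert_space) \<Rightarrow> 'a \<Rightarrow> bool"
    (infixr "weakly'_sums" 80)
  where "u weakly_sums x \<longleftrightarrow> (\<forall>h. (\<lambda>k. cinner (u k) h) sums cinner x h)"

definition pair_frame_operator ::
    "(nat \<Rightarrow> 'a::complex_hilbert_space) \<Rightarrow> (nat \<Rightarrow> 'a) \<Rightarrow> 'a \<Rightarrow> 'a"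
  where "pair_frame_operator F G f = (THE x. (\<lambda>k. cinner f (F k) *\<^sub>C G k) weakly_sums x)"

definition bounded_clinear ::
    "('a::complex_hilbert_space \<Rightarrow> 'b::complex_hilbert_space) \<Rightarrow> bool"
  where "bounded_clinear T \<longleftrightarrow> bounded_linear T \<and> (\<forall>c x. T (c *\<^sub>C x) = c *\<^sub>C T x)"

definition invertible_operator :: "('a::complex_hilbert_space \<Rightarrow> 'a) \<Rightarrow> bool"
  where "invertible_operator S \<longleftrightarrow>
    bounded_clinear S \<and> (\<exists>T. bounded_clinear T \<and> T \<circ> S = id \<and> S \<circ> T = id)"

definition pair_frame ::
    "(nat \<Rightarrow> 'a::complex_hilbert_space) \<Rightarrow> (nat \<Rightarrow> 'a) \<Rightarrow> bool"
  where "pair_frame F G \<longleftrightarrow>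
    (\<forall>f. \<exists>x. (\<lambda>k. cinner f (F k) *\<^sub>C G k) weakly_sums x) \<and>
    invertible_operator (pair_frame_operator F G)"

end

theory Submission
  imports Defs
begin

text \<open>By polarization, \<open>\<Phi> f h = \<Sum>k. \<langle>f, f\<^sub>k\<rangle> \<langle>g\<^sub>k, h\<rangle>\<close> converges for all \<open>f\<close> and \<open>h\<close>, and since it is real
  on the diagonal it is a Hermitian form, whose quadratic form is equivalent to the squared norm.
  The Riesz representation theorem holds for every such form, in particular both for the inner product
  and for \<open>\<Phi>\<close>. Representing \<open>\<Phi> f\<close> by the inner product gives the vector \<open>S f\<close>;
  representing \<open>\<langle>y, \<cdot>\<rangle>\<close> by \<open>\<Phi>\<close> gives a preimage of \<open>y\<close> under \<open>S\<close>.\<close>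

section \<open>Real symmetric bilinear forms\<close>

text \<open>Polarization writes \<open>4 * b u v\<close> as a difference of diagonal values; the
  subtracted one is nonnegative, so the bound on the diagonal controls the whole form.\<close>

lemma symmetric_form_bound:
  fixes b :: "'a::real_normed_vector \<Rightarrow> 'a \<Rightarrow> real"
  assumes bil: "bilinear b"
    and sym: "\<And>x y. b x y = b y x"
    and nonneg: "\<And>x. 0 \<le> b x x"
    and upper: "\<And>x. b x x \<le> B * (norm x)\<^sup>2"
  shows "\<bar>b x y\<bar> \<le> B * norm x * norm y"
proof -
  have le: "b x y \<le> B * norm x * norm y" for x y
  proof (cases "x = 0 \<or> y = 0")
    case True
    then show ?thesis
      using bilinear_lzero[OF bil] bilinear_rzero[OF bil] by auto
  next
    case False
    then have pos: "norm x * norm y > 0" by simp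
    have "0 \<le> B * (norm x)\<^sup>2"
      using nonneg upper order_trans by blast
    then have B: "B \<ge> 0"
      using False by (simp add: zero_le_mult_iff)
    \<comment> \<open>Both vectors have norm \<open>norm x * norm y\<close>; this balancing makes
      the constant exactly \<open>B\<close>.\<close>
    define u v where "u = norm y *\<^sub>R x" and "v = norm x *\<^sub>R y"
    have norms: "norm (u + v) \<le> 2 * (norm x * norm y)"
      using norm_triangle_ineq[of u v] by (simp add: u_def v_def algebra_simps)
    have "4 * (norm x * norm y) * b x y = 4 * b u v"
      by (simp add: u_def v_def bilinear_lmul[OF bil] bilinear_rmul[OF bil])
    also have "\<dots> = b (u + v) (u + v) - b (u - v) (u - v)"
      using sym[of u v]
      by (simp add: bilinear_ladd[OF bil] bilinear_radd[OF bil] bilinear_lsub[OF bil]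
          bilinear_rsub[OF bil])
    also have "\<dots> \<le> B * (norm (u + v))\<^sup>2"
      using nonneg[of "u - v"] upper[of "u + v"] by linarith
    also have "\<dots> \<le> B * (2 * (norm x * norm y))\<^sup>2"
      by (intro mult_left_mono power_mono norms B) auto
    also have "\<dots> = 4 * (norm x * norm y) * (B * norm x * norm y)"
      by (simp add: power2_eq_square)
    finally show ?thesis
      using pos by (simp add: mult_le_cancel_left_pos)
  qed
  from le[of x y] le[of x "- y"] show ?thesis
    by (simp add: bilinear_rneg[OF bil] abs_le_iff)
qed

text \<open>Stated with the midpoint, whose value is later compared with an infimum.\<close>

lemma bilinear_form_parallelogram:
  fixes b :: "'a::real_normed_vector \<Rightarrow> 'a \<Rightarrow> real"
  assumes bil: "bilinear b"
  shows "b (x - y) (x - y) + 4 * b ((1/2) *\<^sub>R (x + y)) ((1/2) *\<^sub>R (x + y)) = 2 * b x x + 2 * b y y"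
  by (simp add: bilinear_ladd[OF bil] bilinear_radd[OF bil] bilinear_lsub[OF bil]
          bilinear_rsub[OF bil] bilinear_lmul[OF bil] bilinear_rmul[OF bil] field_simps)

text \<open>The representing vector is the minimizer of \<open>x \<mapsto> b x x - 2 * l x\<close>; the parallelogram law makes
  minimizing sequences Cauchy.\<close>

lemma symmetric_form_representation:
  fixes b :: "'a::banach \<Rightarrow> 'a \<Rightarrow> real" and l :: "'a \<Rightarrow> real"
  assumes bil: "bilinear b"
    and sym: "\<And>x y. b x y = b y x"
    and A: "A > 0" and lower: "\<And>x. A * (norm x)\<^sup>2 \<le> b x x"
    and upper: "\<And>x. b x x \<le> B * (norm x)\<^sup>2"
    and l: "bounded_linear l"
  shows "\<exists>u. \<forall>h. b u h = l h"
proof -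
  interpret l: bounded_linear l by fact
  have nonneg: "0 \<le> b x x" for x
    using lower[of x] A by (meson mult_nonneg_nonneg less_imp_le order_trans zero_le_power2)
  have bb: "bounded_bilinear b"
  proof
    show "\<exists>K. \<forall>x y. norm (b x y) \<le> norm x * norm y * K"
      using symmetric_form_bound[OF bil sym nonneg upper]
      by (intro exI[of _ B]) (simp add: mult.commute mult.left_commute)
  qed (auto simp: bilinear_ladd[OF bil] bilinear_radd[OF bil] bilinear_lmul[OF bil]
        bilinear_rmul[OF bil])
  define J where "J = (\<lambda>x. b x x - 2 * l x)"
  obtain K where K: "\<And>x. \<bar>l x\<bar> \<le> norm x * K"
    using l.bounded by auto
  have J_below: "- (K\<^sup>2 / A) \<le> J x" for x
  proof -
    \<comment> \<open>The factor \<open>A\<close> turns the lower bound into a completed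
      square.\<close>
    have "A * J x \<ge> A * (A * (norm x)\<^sup>2 - 2 * (norm x * K))"
      using lower[of x] K[of x] A by (intro mult_left_mono) (auto simp: J_def)
    moreover have "A * (A * (norm x)\<^sup>2 - 2 * (norm x * K)) + K\<^sup>2 = (A * norm x - K)\<^sup>2"
      by (simp add: power2_eq_square algebra_simps)
    ultimately have "- K\<^sup>2 \<le> A * J x"
      using zero_le_power2[of "A * norm x - K"] by linarith
    then show ?thesis using A by (simp add: field_simps)
  qed
  define m where "m = (INF x. J x)"
  have bdd: "bdd_below (range J)"
    using J_below by (rule bdd_belowI2)
  have m: "m \<le> J x" for x
    unfolding m_def by (intro cINF_lower bdd) auto
  have "\<exists>x. J x < m + 1 / real (Suc n)" for n
    using cInf_lessD[of "range J" "m + 1 / real (Suc n)"] by (auto simp: m_def)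
  then obtain X where X: "\<And>n. J (X n) < m + 1 / real (Suc n)" by metis
  \<comment> \<open>In the parallelogram law the linear terms cancel, leaving
    \<open>2 * J x + 2 * J y - 4 * J z\<close> for the midpoint \<open>z\<close>, and
    \<open>J z\<close> is at least \<open>m\<close>.\<close>
  have J_mid: "b (x - y) (x - y) \<le> 2 * (J x - m) + 2 * (J y - m)" for x y
  proof -
    define z where "z = (1/2) *\<^sub>R (x + y)"
    have "2 * l z = l x + l y" by (simp add: z_def l.scaleR l.add)
    moreover have "b (x - y) (x - y) + 4 * b z z = 2 * b x x + 2 * b y y"
      unfolding z_def by (rule bilinear_form_parallelogram[OF bil])
    ultimately show ?thesis
      using m[of z] unfolding J_def by argo
  qed
  have "Cauchy X"
  proof (rule metric_CauchyI)
    fix e :: real assume e: "e > 0"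
    \<comment> \<open>If two values of \<open>J\<close> lie within \<open>d\<close> of
      \<open>m\<close>, the bound in \<open>J_mid\<close> is below \<open>4 * d\<close>, that is
      \<open>A * e\<^sup>2\<close>.\<close>
    define d where "d = A * e\<^sup>2 / 4"
    have d: "d > 0" "A * e\<^sup>2 = 4 * d" using A e by (simp_all add: d_def)
    obtain N where N: "1 / real (Suc N) < d"
      using nat_approx_posE[OF d(1)] by blast
    have "dist (X i) (X j) < e" if "i \<ge> N" "j \<ge> N" for i j
    proof -
      have small: "J (X k) - m < d" if "k \<ge> N" for k
      proof -
        have "1 / real (Suc k) \<le> 1 / real (Suc N)"
          using that by (intro divide_left_mono) auto
        then show ?thesis using X[of k] N by linarith
      qed
      have "A * (norm (X i - X j))\<^sup>2 < A * e\<^sup>2"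
        using lower[of "X i - X j"] J_mid[of "X i" "X j"] small[OF that(1)] small[OF that(2)] d(2)
        by argo
      then have "(norm (X i - X j))\<^sup>2 < e\<^sup>2" using A by simp
      then show ?thesis using e by (simp add: dist_norm power_less_imp_less_base)
    qed
    then show "\<exists>N. \<forall>i\<ge>N. \<forall>j\<ge>N. dist (X i) (X j) < e" by blast
  qed
  then obtain u where u: "X \<longlonglongrightarrow> u"
    using Cauchy_convergent convergent_def by blast
  have "(\<lambda>n. J (X n)) \<longlonglongrightarrow> J u"
    unfolding J_def
    by (intro tendsto_diff tendsto_mult tendsto_const bounded_bilinear.tendsto[OF bb] l.tendsto u)
  moreover have "(\<lambda>n. m + 1 / real (Suc n)) \<longlonglongrightarrow> m + 0"
    by (intro tendsto_add tendsto_const LIMSEQ_Suc[OF lim_1_over_n])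
  ultimately have "J u \<le> m + 0"
    by (rule LIMSEQ_le) (intro exI[of _ 0] allI impI less_imp_le X)
  then have "J u \<le> m" by simp
  have "b u h = l h" for h
  proof (rule ccontr)
    \<comment> \<open>The derivative of \<open>J\<close> at \<open>u\<close> along \<open>h\<close>
      is \<open>2 * d\<close>. The step \<open>t = - d / c\<close> lowers \<open>J\<close> by at
      least \<open>d\<^sup>2 / c\<close>; the summand 1 keeps \<open>c\<close> positive when
      \<open>h = 0\<close>.\<close>
    define d where "d = b u h - l h"
    define c where "c = b h h + 1"
    assume "b u h \<noteq> l h"
    then have d: "d\<^sup>2 > 0" by (simp add: d_def)
    have c: "c > 0" "b h h < c" using nonneg[of h] by (auto simp: c_def)
    define t where "t = - d / c"
    have "J (u + t *\<^sub>R h) = J u + t\<^sup>2 * b h h + 2 * t * d"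
      using sym[of u h]
      by (simp add: J_def d_def bilinear_ladd[OF bil] bilinear_radd[OF bil] bilinear_lmul[OF bil]
          bilinear_rmul[OF bil] l.add l.scaleR power2_eq_square algebra_simps)
    moreover have "t\<^sup>2 * b h h \<le> t\<^sup>2 * c" using c by (intro mult_left_mono) auto
    moreover have "t\<^sup>2 * c = d\<^sup>2 / c" "2 * t * d = - (2 * (d\<^sup>2 / c))"
      using c by (auto simp: t_def power2_eq_square field_simps)
    moreover have "d\<^sup>2 / c > 0" using c d by simp
    ultimately show False using m[of "u + t *\<^sub>R h"] \<open>J u \<le> m\<close> by linarith
  qed
  then show ?thesis by blast
qed

section \<open>Coercive Hermitian forms\<close>

locale coercive_form =
  fixes \<phi> :: "'a::complex_hilbert_space \<Rightarrow> 'a \<Rightarrow> complex" and A B :: real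
  assumes add_left: "\<phi> (x + y) z = \<phi> x z + \<phi> y z"
    and scaleC_left: "\<phi> (c *\<^sub>C x) z = c * \<phi> x z"
    and hermitian: "\<phi> x y = cnj (\<phi> y x)"
    and pos: "A > 0"
    and lower: "A * (norm x)\<^sup>2 \<le> Re (\<phi> x x)"
    and upper: "Re (\<phi> x x) \<le> B * (norm x)\<^sup>2"
begin

lemma scaleC_right: "\<phi> x (c *\<^sub>C y) = cnj c * \<phi> x y"
  by (metis complex_cnj_mult hermitian scaleC_left)

lemma Re_commute: "Re (\<phi> x y) = Re (\<phi> y x)"
  by (metis cnj.sel(1) hermitian)

lemma bilinear_Re: "bilinear (\<lambda>x y. Re (\<phi> x y))"
proof -
  have left: "linear (\<lambda>x. Re (\<phi> x y))" for y
    by (rule linearI) (simp_all add: add_left scaleC_left flip: scaleC_of_real)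
  then have "linear (\<lambda>y. Re (\<phi> x y))" for x
    using Re_commute[of x] by simp
  with left show ?thesis by (simp add: bilinear_def)
qed

lemma Re_bound: "\<bar>Re (\<phi> x y)\<bar> \<le> B * norm x * norm y"
proof (rule symmetric_form_bound[OF bilinear_Re Re_commute _ upper])
  show "0 \<le> Re (\<phi> x x)" for x
    using lower[of x] pos by (meson mult_nonneg_nonneg less_imp_le order_trans zero_le_power2)
qed

lemma bounded_linear_Re: "bounded_linear (\<lambda>y. Re (\<phi> x y))"
proof -
  have "linear (\<lambda>y. Re (\<phi> x y))"
    using bilinear_Re by (simp add: bilinear_def)
  then show ?thesis
    using Re_bound[of x]
    by (intro bounded_linear_intro[where K = "B * norm x"]) (auto simp: linear_iff mult.commute)
qed

text \<open>\<open>Im (\<phi> x h)\<close> is \<open>Re (\<phi> x (\<i> *\<^sub>C h))\<close>, so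
  the real parts at all vectors determine the imaginary parts.\<close>

lemma eqI_Re:
  assumes "coercive_form \<psi> A' B'" and eq: "\<And>h. Re (\<phi> x h) = Re (\<psi> y h)"
  shows "\<phi> x h = \<psi> y h"
proof -
  have "Re (\<phi> x (\<i> *\<^sub>C h)) = Re (\<psi> y (\<i> *\<^sub>C h))" by (rule eq)
  then have "Im (\<phi> x h) = Im (\<psi> y h)"
    by (simp add: scaleC_right coercive_form.scaleC_right[OF assms(1)])
  then show ?thesis using eq by (simp add: complex_eq_iff)
qed

text \<open>The real representation theorem handles the real parts, and \<open>eqI_Re\<close>
  restores the imaginary ones. Keeping both forms arbitrary lets the inner product take either
  role.\<close>

lemma representation:
  assumes "coercive_form \<psi> A' B'"
  shows "\<exists>u. \<forall>h. \<phi> u h = \<psi> y h"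
  using symmetric_form_representation[OF bilinear_Re Re_commute pos lower upper
      coercive_form.bounded_linear_Re[OF assms, of y]] eqI_Re[OF assms]
  by metis

end

section \<open>The inner product and weak sums\<close>

lemma coercive_form_cinner: "coercive_form cinner 1 1"
proof
  show "cinner x y = cnj (cinner y x)" for x y :: 'a by (rule cinner_commute)
qed (auto simp: cinner_add_left cinner_scaleC_left cinner_ge_zero norm_eq_sqrt_cinner)

lemma Re_cinner_self: "Re (cinner x x) = (norm x)\<^sup>2"
  by (simp add: norm_eq_sqrt_cinner cinner_ge_zero)

lemma cinner_add_right: "cinner x (y + z) = cinner x y + cinner x z"
  by (metis cinner_add_left cinner_commute complex_cnj_add)

lemma cinner_scaleC_right: "cinner x (c *\<^sub>C y) = cnj c * cinner x y"
  by (rule coercive_form.scaleC_right[OF coercive_form_cinner])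

lemma cinner_diff_left: "cinner (x - y) z = cinner x z - cinner y z"
  using cinner_add_left[of "x - y" y z] by simp

lemma cinner_diff_right: "cinner x (y - z) = cinner x y - cinner x z"
  using cinner_add_right[of x "y - z" z] by simp

lemma cinner_ext:
  assumes "\<And>h. cinner x h = cinner y h"
  shows "x = y"
proof -
  have "(norm (x - y))\<^sup>2 = 0"
    using assms[of "x - y"] by (simp add: cinner_diff_left flip: Re_cinner_self)
  then show ?thesis by simp
qed

text \<open>Ensures that the definite description in \<open>pair_frame_operator\<close> denotes any
  weak sum that has been found.\<close>

lemma weakly_sums_unique: "u weakly_sums x \<Longrightarrow> u weakly_sums y \<Longrightarrow> x = y"
  unfolding weakly_sums_def by (blast intro: cinner_ext sums_unique2)

section \<open>The sesquilinear form of a biframe\<close>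

text \<open>Complex polarization, term by term: each term is a fixed combination of four diagonal
  terms, and such combinations preserve even conditional convergence.\<close>

lemma biframe_sesquilinear_summable:
  assumes "\<And>f. summable (\<lambda>k. cinner f (F k) * cinner (G k) f)"
  shows "summable (\<lambda>k. cinner f (F k) * cinner (G k) h)"
proof -
  let ?a = "\<lambda>f k. cinner f (F k) * cinner (G k) f"
  have "(\<lambda>k. cinner f (F k) * cinner (G k) h) =
      (\<lambda>k. (?a (f + h) k - ?a (f - h) k + \<i> * ?a (f + \<i> *\<^sub>C h) k - \<i> * ?a (f - \<i> *\<^sub>C h) k) / 4)"
    by (rule ext) (simp add: cinner_add_left cinner_add_right cinner_diff_left cinner_diff_right
      cinner_scaleC_left cinner_scaleC_right algebra_simps)
  then show ?thesis
    by (auto intro!: summable_divide summable_diff summable_add summable_mult assms)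
qed

text \<open>A single term of the series need not be Hermitian; the symmetry appears only in the sum
  and comes from its real diagonal.\<close>

lemma biframe_coercive_form:
  assumes "biframe F G"
  obtains \<phi> A B where "coercive_form \<phi> A B"
    and "\<And>f h. (\<lambda>k. cinner f (F k) * cinner (G k) h) sums \<phi> f h"
proof -
  obtain A B where A: "A > 0" and "\<forall>f. \<exists>s::real.
      (\<lambda>k. cinner f (F k) * cinner (G k) f) sums complex_of_real s \<and>
      A * (norm f)\<^sup>2 \<le> s \<and> s \<le> B * (norm f)\<^sup>2"
    using assms unfolding biframe_def by blast
  then obtain q where
    q: "\<And>f. (\<lambda>k. cinner f (F k) * cinner (G k) f) sums complex_of_real (q f)"
    and bounds: "\<And>f. A * (norm f)\<^sup>2 \<le> q f" "\<And>f. q f \<le> B * (norm f)\<^sup>2"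
    unfolding choice_iff by blast
  define \<phi> where "\<phi> f h = (\<Sum>k. cinner f (F k) * cinner (G k) h)" for f h
  have \<phi>: "(\<lambda>k. cinner f (F k) * cinner (G k) h) sums \<phi> f h" for f h
    unfolding \<phi>_def
    by (rule summable_sums, rule biframe_sesquilinear_summable, rule sums_summable, rule q)
  have diag: "\<phi> f f = complex_of_real (q f)" for f
    using \<phi> q sums_unique2 by blast
  have add_left: "\<phi> (x + y) z = \<phi> x z + \<phi> y z" for x y z
    using sums_unique2[OF \<phi>[of "x + y" z]] sums_add[OF \<phi>[of x z] \<phi>[of y z]]
    by (simp add: cinner_add_left algebra_simps)
  have add_right: "\<phi> x (y + z) = \<phi> x y + \<phi> x z" for x y z
    using sums_unique2[OF \<phi>[of x "y + z"]] sums_add[OF \<phi>[of x y] \<phi>[of x z]]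
    by (simp add: cinner_add_right algebra_simps)
  have scale_left: "\<phi> (c *\<^sub>C x) z = c * \<phi> x z" for c x z
    using sums_unique2[OF \<phi>[of "c *\<^sub>C x" z]] sums_mult[OF \<phi>[of x z], of c]
    by (simp add: cinner_scaleC_left algebra_simps)
  have scale_right: "\<phi> x (c *\<^sub>C z) = cnj c * \<phi> x z" for c x z
    using sums_unique2[OF \<phi>[of x "c *\<^sub>C z"]] sums_mult[OF \<phi>[of x z], of "cnj c"]
    by (simp add: cinner_scaleC_right algebra_simps)
  \<comment> \<open>Expanding the real diagonal value at \<open>x + y\<close> leaves
    \<open>Im (\<phi> x y) + Im (\<phi> y x) = 0\<close>.\<close>
  have Im: "Im (\<phi> x y) = - Im (\<phi> y x)" for x y
  proof -
    have "Im (\<phi> (x + y) (x + y)) = 0" "Im (\<phi> x x) = 0" "Im (\<phi> y y) = 0"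
      by (simp_all add: diag)
    then show ?thesis by (simp add: add_left add_right)
  qed
  \<comment> \<open>Replacing \<open>y\<close> by \<open>\<i> *\<^sub>C y\<close> turns imaginary
    parts into real parts.\<close>
  have Re: "Re (\<phi> x y) = Re (\<phi> y x)" for x y
    using Im[of x "\<i> *\<^sub>C y"] by (simp add: scale_left scale_right)
  have "coercive_form \<phi> A B"
  proof
    show "\<phi> x y = cnj (\<phi> y x)" for x y
      using Im[of x y] Re[of x y] by (simp add: complex_eq_iff)
  qed (use A bounds in \<open>auto simp: add_left scale_left diag\<close>)
  then show thesis using \<phi> that by blast
qed

section \<open>Invertibility of the represented operator\<close>

lemma scaleR_eq_scaleC: "r *\<^sub>R x = complex_of_real r *\<^sub>C x"
  by (simp add: scaleC_of_real)

lemma bounded_clinearI: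
  assumes "\<And>x y. T (x + y) = T x + T y" and scale: "\<And>c x. T (c *\<^sub>C x) = c *\<^sub>C T x"
    and "\<And>x. norm (T x) \<le> norm x * K"
  shows "bounded_clinear T"
  unfolding bounded_clinear_def
  using assms by (auto intro!: bounded_linear_intro[where K = K] simp: scaleR_eq_scaleC)

text \<open>The upper bound makes \<open>S\<close> bounded, the lower bound gives injectivity and a
  bounded inverse, and representing inner product functionals by \<open>\<phi>\<close> gives
  surjectivity.\<close>

lemma coercive_form_invertible_operator:
  assumes "coercive_form \<phi> A B" and S: "\<And>f h. cinner (S f) h = \<phi> f h"
  shows "invertible_operator S"
proof -
  interpret coercive_form \<phi> A B by fact
  have add: "S (x + y) = S x + S y" for x y
    by (rule cinner_ext) (simp add: S cinner_add_left add_left)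
  have scale: "S (c *\<^sub>C x) = c *\<^sub>C S x" for c x
    by (rule cinner_ext) (simp add: S cinner_scaleC_left scaleC_left)
  have S_upper: "norm (S f) \<le> norm f * B" for f
  proof (cases "S f = 0")
    case True
    have "0 \<le> B * (norm f)\<^sup>2"
      using lower[of f] upper[of f] pos
      by (meson mult_nonneg_nonneg less_imp_le order_trans zero_le_power2)
    then show ?thesis using True by (auto simp: zero_le_mult_iff)
  next
    case False
    \<comment> \<open>Testing with \<open>S f\<close> itself: \<open>\<phi> f (S f)\<close> is the
      squared norm of \<open>S f\<close>.\<close>
    have "(norm (S f))\<^sup>2 \<le> B * norm f * norm (S f)"
      using Re_bound[of f "S f"] by (simp flip: Re_cinner_self add: S)
    then show ?thesis
      using False by (simp add: power2_eq_square mult.commute)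
  qed
  have S_lower: "A * norm f \<le> norm (S f)" for f
  proof (cases "f = 0")
    case False
    \<comment> \<open>\<open>Re_bound\<close> for the inner product, with constant 1, is the
      Cauchy-Schwarz inequality.\<close>
    have "A * (norm f)\<^sup>2 \<le> norm (S f) * norm f"
      using lower[of f] coercive_form.Re_bound[OF coercive_form_cinner, of "S f" f] by (simp add: S)
    then show ?thesis using False by (simp add: power2_eq_square)
  qed auto
  have diff: "S (x - y) = S x - S y" for x y
    using add[of "x - y" y] by simp
  have inj: "x = y" if "S x = S y" for x y
    using S_lower[of "x - y"] that pos by (simp add: diff mult_le_0_iff)
  have "\<exists>u. S u = y" for y
  proof -
    obtain u where "\<And>h. \<phi> u h = cinner y h"
      using representation[OF coercive_form_cinner] by metis
    then have "S u = y" by (intro cinner_ext[of "S u" y]) (simp add: S)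
    then show ?thesis ..
  qed
  then obtain T where ST: "\<And>y. S (T y) = y" by metis
  have "bounded_clinear S"
    by (rule bounded_clinearI[OF add scale S_upper])
  moreover have "bounded_clinear T"
  proof (rule bounded_clinearI)
    \<comment> \<open>Injectivity of \<open>S\<close> transfers its linearity to \<open>T\<close>:
      both sides have the same image under \<open>S\<close>.\<close>
    show "T (x + y) = T x + T y" for x y by (rule inj) (simp add: add ST)
    show "T (c *\<^sub>C x) = c *\<^sub>C T x" for c x by (rule inj) (simp add: scale ST)
    show "norm (T y) \<le> norm y * (1 / A)" for y
      using S_lower[of "T y"] pos by (simp add: ST field_simps)
  qed
  moreover have "T \<circ> S = id" "S \<circ> T = id"
    using inj ST by (auto simp: fun_eq_iff)
  ultimately show ?thesis unfolding invertible_operator_def by blast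
qed

theorem corollary4p3:
  fixes F G :: "nat \<Rightarrow> 'a::complex_hilbert_space"
  assumes "separable_space (euclidean :: 'a topology)"
    and "biframe F G"
  shows "pair_frame F G"
proof -
  obtain \<phi> A B where form: "coercive_form \<phi> A B"
    and \<phi>: "\<And>f h. (\<lambda>k. cinner f (F k) * cinner (G k) h) sums \<phi> f h"
    using biframe_coercive_form[OF assms(2)] by blast
  obtain S where S: "\<And>f h. cinner (S f) h = \<phi> f h"
    using coercive_form.representation[OF coercive_form_cinner form] by metis
  \<comment> \<open>Pairing the vector series with \<open>h\<close> moves the scalars out and yields
    the series of \<open>\<phi> f h\<close>.\<close>
  have weak: "(\<lambda>k. cinner f (F k) *\<^sub>C G k) weakly_sums S f" for f
    unfolding weakly_sums_def using \<phi> by (simp add: cinner_scaleC_left S)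
  then have "pair_frame_operator F G f = S f" for f
    unfolding pair_frame_operator_def by (blast intro: weakly_sums_unique)
  then have "pair_frame_operator F G = S" ..
  then show ?thesis
    unfolding pair_frame_def using weak coercive_form_invertible_operator[OF form S] by metis
qed

end
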